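(* Let $\varphi(\mu)$ be a (lightface) $\Sigma^1_2$ formula such that in $L$ the set $\mathcal A=\{\mu\in P(2^\omega)\cap L: L\models\varphi(\mu)\}$ is a maximal orthogonal family of measures in $P(2^\omega)$. Suppose there is a subset of $\omega$ which is not in $L$. Then $\mathcal A$ is not a maximal orthogonal family in $P(2^\omega)$ (in $V$).
   Context: $P(2^\omega)$ is the space of Borel probability measures on Cantor space $2^\omega$, with its standard structure as an effectively presented Polish space. Two measures $\mu,\nu$ are orthogonal, $\mu\perp\nu$, if there is a Borel set $B$ with $\nu(B)=1$ and $\mu(B)=0$. An orthogonal family is a set of pairwise orthogonal measures in $P(2^\omega)$; a maximal orthogonal family (mof) is one that is maximal under inclusion among orthogonal families. $L$ is G\"odel's constructible universe. *)

theory Defs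
  imports "HOL-Probability.Probability" "HOL-Library.Countable_Set_Type"
begin

section \<open>The universe of sets and the constructible hierarchy\<close>

text \<open>
  A type of class \<open>set_universe\<close> plays the role of \<open>V\<close>: its elements are sets, \<open>elts\<close> is the
  membership relation, and a HOL set \<open>A\<close> is a set of the universe iff \<open>A \<in> range elts\<close>.
  The axioms are those of ZFC with Replacement in its second-order form (Separation follows,
  Choice is inherited from HOL). Power Set is not required, so that the class
  contains the universes satisfying full ZFC, on which the definitions below give the class \<open>L\<close> in
  its usual sense, but also has an instance definable in HOL (the hereditarily countable sets,
  below). By Replacement every HOL set of natural numbers is represented in the universe.
\<close>

class set_universe =
  fixes elts :: "'a \<Rightarrow> 'a set"
  assumes extensionality: "elts x = elts y \<Longrightarrow> x = y"
    and foundation: "wf {(x, y). x \<in> elts y}"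
    and empty: "{} \<in> range elts"
    and pairing: "{x, y} \<in> range elts"
    and union: "A \<in> range elts \<Longrightarrow> \<Union> (elts ` A) \<in> range elts"
    and replacement: "A \<in> range elts \<Longrightarrow> f ` A \<in> range elts"
    and infinity: "\<exists>x. infinite (elts x)"

datatype hc = HC "hc cset"

instantiation hc :: set_universe
begin

primrec elts_hc :: "hc \<Rightarrow> hc set" where
  "elts_hc (HC X) = rcset X"

lemma range_elts_hc: "range (elts :: hc \<Rightarrow> hc set) = {A. countable A}"
proof (intro set_eqI iffI)
  fix A :: "hc set" assume "A \<in> {A. countable A}"
  then have "elts (HC (acset A)) = A" by simp
  then show "A \<in> range elts" by (metis rangeI)
next
  fix A :: "hc set" assume "A \<in> range elts"
  then obtain x where "A = elts x" by blast
  then show "A \<in> {A. countable A}" by (cases x) simp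
qed

instance
proof
  fix x y :: hc and A :: "hc set" and f :: "hc \<Rightarrow> hc"
  show "elts x = elts y \<Longrightarrow> x = y"
    by (cases x; cases y) (simp add: rcset_inject)
  show "wf {(x :: hc, y). x \<in> elts y}"
  proof (rule wfUNIVI)
    fix P :: "hc \<Rightarrow> bool" and x
    assume step: "\<forall>x. (\<forall>y. (y, x) \<in> {(x, y). x \<in> elts y} \<longrightarrow> P y) \<longrightarrow> P x"
    show "P x"
    proof (induction x)
      case (HC X)
      then show ?case using step by simp
    qed
  qed
  show "{} \<in> range (elts :: hc \<Rightarrow> hc set)" and "{x, y} \<in> range elts"
    by (simp_all add: range_elts_hc)
  show "A \<in> range elts \<Longrightarrow> \<Union> (elts ` A) \<in> range elts"
  proof -
    assume "A \<in> range elts"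
    moreover have "countable (elts z)" for z :: hc using range_elts_hc by blast
    ultimately show ?thesis by (simp add: range_elts_hc)
  qed
  show "A \<in> range elts \<Longrightarrow> f ` A \<in> range elts"
    by (simp add: range_elts_hc)
  define g where "g = rec_nat (HC (acset {})) (\<lambda>_ x. HC (acset {x}))"
  have g: "elts (g 0) = {}" "elts (g (Suc n)) = {g n}" for n by (simp_all add: g_def)
  have "g m = g n \<Longrightarrow> m = n" for m n
  proof (induction m arbitrary: n)
    case 0
    then show ?case by (metis g insert_not_empty not0_implies_Suc)
  next
    case (Suc m)
    then show ?case by (metis g insert_not_empty not0_implies_Suc singleton_inject)
  qed
  then have "inj g" by (simp add: inj_def)
  then have "infinite (range g)" by (rule range_inj_infinite)
  moreover have "elts (HC (acset (range g))) = range g" by simp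
  ultimately show "\<exists>x :: hc. infinite (elts x)" by metis
qed

end

text \<open>Formulas of the language of set theory, with named variables.\<close>

datatype set_fm =
    SMem nat nat
  | SEq nat nat
  | SNeg set_fm
  | SConj set_fm set_fm
  | SEx nat set_fm

primrec set_fv :: "set_fm \<Rightarrow> nat set" where
  "set_fv (SMem i j) = {i, j}"
| "set_fv (SEq i j) = {i, j}"
| "set_fv (SNeg p) = set_fv p"
| "set_fv (SConj p q) = set_fv p \<union> set_fv q"
| "set_fv (SEx i p) = set_fv p - {i}"

primrec set_sat :: "'v::set_universe set \<Rightarrow> set_fm \<Rightarrow> (nat \<Rightarrow> 'v) \<Rightarrow> bool" where
  "set_sat X (SMem i j) e \<longleftrightarrow> e i \<in> elts (e j)"
| "set_sat X (SEq i j) e \<longleftrightarrow> e i = e j"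
| "set_sat X (SNeg p) e \<longleftrightarrow> \<not> set_sat X p e"
| "set_sat X (SConj p q) e \<longleftrightarrow> set_sat X p e \<and> set_sat X q e"
| "set_sat X (SEx i p) e \<longleftrightarrow> (\<exists>x\<in>X. set_sat X p (e(i := x)))"

text \<open>
  The definable power set of \<open>X\<close>. Only the parameters that occur in the formula have to lie in
  \<open>X\<close>: with \<open>range e \<subseteq> X\<close> the definable power set of the empty set would be empty.
\<close>

definition Def :: "'v::set_universe set \<Rightarrow> 'v set" where
  "Def X = {y. \<exists>p e. e ` (set_fv p - {0}) \<subseteq> X \<and> elts y = {x \<in> X. set_sat X p (e(0 := x))}}"

text \<open>\<open>L\<^sub>\<alpha> = \<Union>\<^bsub>\<beta><\<alpha>\<^esub> Def L\<^sub>\<beta>\<close>; on ordinals this is the usual recursion with its zero, successor and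
  limit clauses.\<close>

function Lset :: "'v::set_universe \<Rightarrow> 'v set" where
  "Lset a = (\<Union>b\<in>elts a. Def (Lset b))"
  by auto
termination
  by (relation "{(x, y). x \<in> elts y}") (use foundation in auto)

declare Lset.simps [simp del]

definition Ord :: "'v::set_universe \<Rightarrow> bool" where
  "Ord a \<longleftrightarrow> (\<forall>b\<in>elts a. elts b \<subseteq> elts a \<and> (\<forall>c\<in>elts b. elts c \<subseteq> elts b))"

definition L_class :: "'v::set_universe set" where
  "L_class = {x. \<exists>a. Ord a \<and> x \<in> Lset a}"

primrec vnat :: "nat \<Rightarrow> 'v::set_universe" where
  "vnat 0 = (THE x. elts x = {})"
| "vnat (Suc n) = (THE x. elts x = insert (vnat n) (elts (vnat n)))"

definition L_reals :: "'v::set_universe itself \<Rightarrow> nat set set" where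
  "L_reals TYPE('v) = {x. \<exists>v\<in>(L_class :: 'v set). elts v = vnat ` x}"


section \<open>Formulas of second-order arithmetic\<close>

datatype tm = NVar nat | Zero | Succ tm | Plus tm tm | Times tm tm

datatype so_fm =
    NEq tm tm
  | InS tm nat
  | Neg so_fm
  | Conj so_fm so_fm
  | ExN nat so_fm
  | ExS nat so_fm
  | AllS nat so_fm

primrec tm_val :: "tm \<Rightarrow> (nat \<Rightarrow> nat) \<Rightarrow> nat" where
  "tm_val (NVar i) e = e i"
| "tm_val Zero e = 0"
| "tm_val (Succ t) e = Suc (tm_val t e)"
| "tm_val (Plus s t) e = tm_val s e + tm_val t e"
| "tm_val (Times s t) e = tm_val s e * tm_val t e"

text \<open>Satisfaction in the \<open>\<omega>\<close>-model with second-order part \<open>R\<close>: with \<open>R = P(\<omega>) \<inter> L\<close> this is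
  satisfaction relativized to \<open>L\<close>.\<close>

primrec so_sat :: "nat set set \<Rightarrow> so_fm \<Rightarrow> (nat \<Rightarrow> nat) \<Rightarrow> (nat \<Rightarrow> nat set) \<Rightarrow> bool" where
  "so_sat R (NEq s t) e E \<longleftrightarrow> tm_val s e = tm_val t e"
| "so_sat R (InS t i) e E \<longleftrightarrow> tm_val t e \<in> E i"
| "so_sat R (Neg p) e E \<longleftrightarrow> \<not> so_sat R p e E"
| "so_sat R (Conj p q) e E \<longleftrightarrow> so_sat R p e E \<and> so_sat R q e E"
| "so_sat R (ExN i p) e E \<longleftrightarrow> (\<exists>n. so_sat R p (e(i := n)) E)"
| "so_sat R (ExS i p) e E \<longleftrightarrow> (\<exists>X\<in>R. so_sat R p e (E(i := X)))"
| "so_sat R (AllS i p) e E \<longleftrightarrow> (\<forall>X\<in>R. so_sat R p e (E(i := X)))"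

primrec arithmetical :: "so_fm \<Rightarrow> bool" where
  "arithmetical (NEq s t) \<longleftrightarrow> True"
| "arithmetical (InS t i) \<longleftrightarrow> True"
| "arithmetical (Neg p) \<longleftrightarrow> arithmetical p"
| "arithmetical (Conj p q) \<longleftrightarrow> arithmetical p \<and> arithmetical q"
| "arithmetical (ExN i p) \<longleftrightarrow> arithmetical p"
| "arithmetical (ExS i p) \<longleftrightarrow> False"
| "arithmetical (AllS i p) \<longleftrightarrow> False"

inductive Pi11 :: "so_fm \<Rightarrow> bool" where
  "arithmetical p \<Longrightarrow> Pi11 p"
| "Pi11 p \<Longrightarrow> Pi11 (AllS i p)"

inductive Sigma12 :: "so_fm \<Rightarrow> bool" where
  "Pi11 p \<Longrightarrow> Sigma12 p"
| "Sigma12 p \<Longrightarrow> Sigma12 (ExS i p)"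

primrec tm_nv :: "tm \<Rightarrow> nat set" where
  "tm_nv (NVar i) = {i}"
| "tm_nv Zero = {}"
| "tm_nv (Succ t) = tm_nv t"
| "tm_nv (Plus s t) = tm_nv s \<union> tm_nv t"
| "tm_nv (Times s t) = tm_nv s \<union> tm_nv t"

primrec so_nfv :: "so_fm \<Rightarrow> nat set" where
  "so_nfv (NEq s t) = tm_nv s \<union> tm_nv t"
| "so_nfv (InS t i) = tm_nv t"
| "so_nfv (Neg p) = so_nfv p"
| "so_nfv (Conj p q) = so_nfv p \<union> so_nfv q"
| "so_nfv (ExN i p) = so_nfv p - {i}"
| "so_nfv (ExS i p) = so_nfv p"
| "so_nfv (AllS i p) = so_nfv p"

primrec so_sfv :: "so_fm \<Rightarrow> nat set" where
  "so_sfv (NEq s t) = {}"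
| "so_sfv (InS t i) = {i}"
| "so_sfv (Neg p) = so_sfv p"
| "so_sfv (Conj p q) = so_sfv p \<union> so_sfv q"
| "so_sfv (ExN i p) = so_sfv p"
| "so_sfv (ExS i p) = so_sfv p - {i}"
| "so_sfv (AllS i p) = so_sfv p - {i}"


section \<open>Measures on Cantor space\<close>

type_synonym cantor = "nat \<Rightarrow> bool"

definition P_cantor :: "cantor measure set" where
  "P_cantor = {\<mu>. sets \<mu> = sets borel \<and> prob_space \<mu>}"

definition orthogonal_measures :: "cantor measure \<Rightarrow> cantor measure \<Rightarrow> bool" where
  "orthogonal_measures \<mu> \<nu> \<longleftrightarrow> (\<exists>B\<in>sets borel. emeasure \<nu> B = 1 \<and> emeasure \<mu> B = 0)"

text \<open>
  The space of measures and the orthogonality relation are parameters, so that the same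
  definition can be read in \<open>V\<close> and relativized to \<open>L\<close>.
\<close>

definition orthogonal_family :: "'m set \<Rightarrow> ('m \<Rightarrow> 'm \<Rightarrow> bool) \<Rightarrow> 'm set \<Rightarrow> bool" where
  "orthogonal_family S orth A \<longleftrightarrow> A \<subseteq> S \<and> (\<forall>\<mu>\<in>A. \<forall>\<nu>\<in>A. \<mu> \<noteq> \<nu> \<longrightarrow> orth \<mu> \<nu>)"

definition mof_wrt :: "'m set \<Rightarrow> ('m \<Rightarrow> 'm \<Rightarrow> bool) \<Rightarrow> 'm set \<Rightarrow> bool" where
  "mof_wrt S orth A \<longleftrightarrow> orthogonal_family S orth A \<and>
     (\<forall>A'. orthogonal_family S orth A' \<and> A \<subseteq> A' \<longrightarrow> A' = A)"

definition mof :: "cantor measure set \<Rightarrow> bool" where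
  "mof = mof_wrt P_cantor orthogonal_measures"

definition cyl :: "bool list \<Rightarrow> cantor set" where
  "cyl s = {x. \<forall>i<length s. x i = s ! i}"

definition str_code :: "bool list \<Rightarrow> nat" where
  "str_code s = list_encode (map of_bool s)"

text \<open>
  The real coding \<open>\<mu>\<close>: the set of all pairs of a string \<open>s\<close> and a nonnegative rational \<open>a / (b + 1)\<close>
  below \<open>\<mu>(N\<^sub>s)\<close>, that is, the left cuts of the function \<open>s \<mapsto> \<mu>(N\<^sub>s)\<close> which determines \<open>\<mu>\<close>. Lightface
  classes from \<open>\<Delta>\<^sup>1\<^sub>1\<close> upwards do not depend on whether the space is presented by these cuts or by
  the usual recursive presentation.
\<close>

definition measure_code :: "cantor measure \<Rightarrow> nat set" where
  "measure_code \<mu> = {prod_encode (str_code s, prod_encode (a, b)) | s a b.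
     real a / real (Suc b) < measure \<mu> (cyl s)}"

text \<open>For \<open>Sigma12\<close> formulas this is lightface: the formula has no parameter besides the measure,
  which is the value of the set variable \<open>0\<close>. All other variables are meant to be bound.\<close>

definition holds_of_measure :: "nat set set \<Rightarrow> so_fm \<Rightarrow> cantor measure \<Rightarrow> bool" where
  "holds_of_measure R \<phi> \<mu> \<longleftrightarrow> so_sat R \<phi> (\<lambda>_. 0) ((\<lambda>_. {})(0 := measure_code \<mu>))"


section \<open>Relativization to an inner model with reals \<open>R\<close>\<close>

text \<open>
  In the following definitions \<open>R\<close> stands for \<open>P(\<omega>) \<inter> M\<close> with \<open>M\<close> an inner model. A measure of \<open>M\<close>
  is identified with the unique Borel measure of \<open>V\<close> that has the same values on the basic clopen
  sets.
\<close>

definition cantor_in :: "nat set set \<Rightarrow> cantor set" where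
  "cantor_in R = {x. {n. x n} \<in> R}"

definition P_in :: "nat set set \<Rightarrow> cantor measure set" where
  "P_in R = {\<mu> \<in> P_cantor. measure_code \<mu> \<in> R}"

text \<open>
  \<open>codes_borel \<Omega> c B\<close>: the real \<open>c\<close> is a Borel code and \<open>B\<close> is the Borel subset of \<open>\<Omega> \<subseteq> 2\<^sup>\<omega>\<close> with that
  code. The base codes are for basic clopen sets; otherwise \<open>c\<close> codes the complement of the union of
  the sets coded by its columns with positive index.
\<close>

inductive codes_borel :: "cantor set \<Rightarrow> nat set \<Rightarrow> cantor set \<Rightarrow> bool" for \<Omega> where
  clopen: "codes_borel \<Omega> {prod_encode (0, str_code s)} (cyl s \<inter> \<Omega>)"
| compl_Union: "(\<And>n. codes_borel \<Omega> {k. prod_encode (Suc n, k) \<in> c} (B n)) \<Longrightarrow>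
    codes_borel \<Omega> c (\<Omega> - (\<Union>n. B n))"

definition borel_in :: "nat set set \<Rightarrow> cantor set set" where
  "borel_in R = {B. \<exists>c\<in>R. codes_borel (cantor_in R) c B}"

text \<open>
  The value that \<open>M\<close> assigns to \<open>\<mu>(B)\<close> for \<open>B \<in> borel_in R\<close>: the outer measure computed with the open
  covers that belong to \<open>M\<close>, which need to cover the points of \<open>M\<close> only. (\<open>B\<close> need not be a Borel set
  of \<open>V\<close>, so \<open>emeasure \<mu> B\<close> would be the wrong notion.)
\<close>

definition emeasure_in :: "nat set set \<Rightarrow> cantor measure \<Rightarrow> cantor set \<Rightarrow> ennreal" where
  "emeasure_in R \<mu> B =
     (INF S\<in>{S. str_code ` S \<in> R \<and> B \<subseteq> (\<Union>s\<in>S. cyl s)}.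
        \<integral>\<^sup>+s. emeasure \<mu> (cyl s) \<partial>count_space S)"

definition orthogonal_in :: "nat set set \<Rightarrow> cantor measure \<Rightarrow> cantor measure \<Rightarrow> bool" where
  "orthogonal_in R \<mu> \<nu> \<longleftrightarrow> (\<exists>B\<in>borel_in R. emeasure_in R \<nu> B = 1 \<and> emeasure_in R \<mu> B = 0)"

definition mof_in :: "nat set set \<Rightarrow> cantor measure set \<Rightarrow> bool" where
  "mof_in R = mof_wrt (P_in R) (orthogonal_in R)"

end

theory Submission
  imports Defs
begin

text \<open>
  Let \<open>x\<close> be a real outside \<open>L\<close>. The point mass at \<open>x\<close> is orthogonal to every constructible
  measure \<open>\<mu>\<close>: otherwise \<open>x\<close> is an atom of \<open>\<mu>\<close>, hence arithmetical in the code of \<open>\<mu>\<close>, since some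
  rational \<open>q < \<mu>{x}\<close> is at least the measure of the rest of some basic neighbourhood of \<open>x\<close>, in which
  \<open>x\<close> is then the only branch through the strings \<open>t\<close> with \<open>\<mu>(N\<^sub>t) > q\<close>. So no family of
  constructible measures is maximal orthogonal in \<open>V\<close>.

  That the branch is again in \<open>L\<close> needs the coding of strings to be definable over \<open>L\<^sub>\<lambda>\<close> for limit
  \<open>\<lambda>\<close>. A triple is in the graph of the pairing function iff it belongs to some element of \<open>L\<^sub>\<lambda>\<close> that is
  closed backwards under the rules generating the graph: finite ones suffice, and all of them are
  sound by foundation. The bits of a code are treated in the same way.
\<close>

section \<open>Sets of the universe\<close>

context set_universe
begin

definition set_of :: "'a set \<Rightarrow> 'a" where
  "set_of = inv elts"

lemma elts_set_of: "A \<in> range elts \<Longrightarrow> elts (set_of A) = A"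
  unfolding set_of_def by (rule f_inv_into_f)

lemma countable_in_range_elts:
  assumes "countable A"
  shows "A \<in> range elts"
proof (cases "A = {}")
  case True
  then show ?thesis using empty by simp
next
  case False
  obtain x where x: "infinite (elts x)" using infinity by blast
  obtain C where C: "countable C" "infinite C" "C \<subseteq> elts x"
    using infinite_countable_subset'[OF x] by blast
  define f where "f z = from_nat_into A (to_nat_on C z)" for z
  \<comment> \<open>Replacement applies to \<open>elts x\<close>, while \<open>C\<close> is not yet
    known to be a set of the universe. So points outside \<open>C\<close> are sent to the value of
    some point of \<open>C\<close>.\<close>
  define g where "g z = (if z \<in> C then f z else f (SOME c. c \<in> C))" for z
  have fC: "f ` C = A"
  proof -
    have "f ` C = from_nat_into A ` (to_nat_on C ` C)"
      by (simp add: f_def image_image)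
    also have "to_nat_on C ` C = UNIV"
      using to_nat_on_infinite[OF C(1,2)] by (simp add: bij_betw_def)
    finally show ?thesis using False assms by (simp add: range_from_nat_into)
  qed
  have "(SOME c. c \<in> C) \<in> C" using C(2) by (metis finite.emptyI some_in_eq)
  then have "g ` elts x = A"
    using fC C(3) by (auto simp: g_def image_iff)
  then show ?thesis using replacement[of "elts x" g] by auto
qed

lemma not_mem_sym: "a \<in> elts b \<Longrightarrow> b \<notin> elts a"
  using foundation by (auto dest: wf_not_sym)

text \<open>Adjunction, which together with the empty set generates the hereditarily finite sets and
  covers successors as the case of equal arguments.\<close>

definition vinsert :: "'a \<Rightarrow> 'a \<Rightarrow> 'a" where
  "vinsert a b = set_of (insert a (elts b))"

text \<open>Since \<open>elts b\<close> may be uncountable, the set is obtained as the union of the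
  pair of \<open>{a}\<close> and \<open>b\<close>.\<close>

lemma elts_vinsert [simp]: "elts (vinsert a b) = insert a (elts b)"
proof -
  obtain u where u: "elts u = {a, a}" using pairing[of a a] by (metis imageE)
  have "\<Union> (elts ` {u, b}) \<in> range elts" using pairing by (rule union)
  then have "insert a (elts b) \<in> range elts" using u by simp
  then show ?thesis by (simp add: vinsert_def elts_set_of)
qed

text \<open>With Kuratowski pairs, a transitive set that contains a pair also contains both
  components.\<close>

definition vpair :: "'a \<Rightarrow> 'a \<Rightarrow> 'a" where
  "vpair a b = set_of {set_of {a}, set_of {a, b}}"

lemma elts_set_of_countable [simp]: "countable A \<Longrightarrow> elts (set_of A) = A"
  by (simp add: countable_in_range_elts elts_set_of)

lemma set_of_eq_iff: "countable A \<Longrightarrow> z = set_of A \<longleftrightarrow> elts z = A"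
  using elts_set_of_countable extensionality by metis

lemma vpair_inject [simp]: "vpair a b = vpair c d \<longleftrightarrow> a = c \<and> b = d"
proof
  assume "vpair a b = vpair c d"
  then have "{set_of {a}, set_of {a, b}} = {set_of {c}, set_of {c, d}}"
    unfolding vpair_def by (metis countable_insert countable_empty elts_set_of_countable)
  then have "elts ` {set_of {a}, set_of {a, b}} = elts ` {set_of {c}, set_of {c, d}}"
    by simp
  then have "{{a}, {a, b}} = {{c}, {c, d}}" by simp
  then show "a = c \<and> b = d" by (auto simp: doubleton_eq_iff)
qed simp

abbreviation vsucc :: "'a \<Rightarrow> 'a" where
  "vsucc a \<equiv> vinsert a a"

text \<open>Otherwise \<open>a\<close> and \<open>b\<close> would be elements of each other, against
  Foundation.\<close>

lemma vsucc_inject [simp]: "vsucc a = vsucc b \<longleftrightarrow> a = b"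
proof
  assume "vsucc a = vsucc b"
  then have "insert a (elts a) = insert b (elts b)" by (metis elts_vinsert)
  then show "a = b" using not_mem_sym by (metis insert_iff)
qed simp

end

lemma elts_vnat_0 [simp]: "elts (vnat 0) = {}"
proof -
  obtain x :: 'a where x: "elts x = {}" using empty by (metis imageE)
  have "elts (THE x :: 'a. elts x = {}) = {}"
    by (rule theI[of _ x]) (auto simp: x intro: extensionality)
  then show ?thesis by simp
qed

lemma vnat_Suc [simp]: "vnat (Suc n) = vsucc (vnat n)"
proof -
  have "(THE x. elts x = insert (vnat n) (elts (vnat n))) = vsucc (vnat n)"
    by (rule the_equality) (auto intro: extensionality)
  then show ?thesis by simp
qed

declare vnat.simps [simp del]

lemma eq_vnat_0_iff: "z = vnat 0 \<longleftrightarrow> elts z = {}"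
  using elts_vnat_0 extensionality by metis

lemma vsucc_neq_vnat_0 [simp]: "vsucc a \<noteq> vnat 0" "vnat 0 \<noteq> vsucc a"
  by (metis elts_vinsert elts_vnat_0 insert_not_empty)+

lemma vnat_inject [simp]: "vnat m = vnat n \<longleftrightarrow> m = n"
proof (induction m arbitrary: n)
  case 0
  then show ?case by (cases n) auto
next
  case (Suc m)
  then show ?case by (cases n) auto
qed

lemma vsucc_eq_vnatE:
  assumes "vsucc a = vnat n"
  obtains m where "n = Suc m" "a = vnat m"
  using assms by (cases n) auto

section \<open>Definable predicates\<close>

text \<open>Predicates on assignments instead of formulas, so that no syntax has to be written down.\<close>

definition dfn :: "'v::set_universe set \<Rightarrow> ((nat \<Rightarrow> 'v) \<Rightarrow> bool) \<Rightarrow> bool" where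
  "dfn X Q \<longleftrightarrow> (\<exists>p. \<forall>e. range e \<subseteq> X \<longrightarrow> set_sat X p e = Q e)"

lemma dfn_cong: "dfn X P \<Longrightarrow> (\<And>e. range e \<subseteq> X \<Longrightarrow> P e = Q e) \<Longrightarrow> dfn X Q"
  unfolding dfn_def by metis

lemma dfn_mem: "dfn X (\<lambda>e. e i \<in> elts (e j))"
  unfolding dfn_def by (rule exI[of _ "SMem i j"]) simp

lemma dfn_eq: "dfn X (\<lambda>e. e i = e j)"
  unfolding dfn_def by (rule exI[of _ "SEq i j"]) simp

lemma dfn_not: "dfn X P \<Longrightarrow> dfn X (\<lambda>e. \<not> P e)"
  unfolding dfn_def by (metis set_sat.simps(3))

lemma dfn_conj: "dfn X P \<Longrightarrow> dfn X Q \<Longrightarrow> dfn X (\<lambda>e. P e \<and> Q e)"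
  unfolding dfn_def by (metis set_sat.simps(4))

lemma dfn_disj: "dfn X P \<Longrightarrow> dfn X Q \<Longrightarrow> dfn X (\<lambda>e. P e \<or> Q e)"
  using dfn_not[OF dfn_conj[OF dfn_not dfn_not]] by fastforce

lemma dfn_imp: "dfn X P \<Longrightarrow> dfn X Q \<Longrightarrow> dfn X (\<lambda>e. P e \<longrightarrow> Q e)"
  using dfn_disj[OF dfn_not] by fastforce

lemma dfn_iff: "dfn X P \<Longrightarrow> dfn X Q \<Longrightarrow> dfn X (\<lambda>e. P e \<longleftrightarrow> Q e)"
  by (rule dfn_cong[OF dfn_conj[OF dfn_imp[of X P Q] dfn_imp[of X Q P]]]) auto

lemma dfn_const: "dfn X (\<lambda>_. P)"
proof (cases P)
  case True
  then show ?thesis using dfn_eq[of X 0 0] by simp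
next
  case False
  then show ?thesis using dfn_not[OF dfn_eq[of X 0 0]] by simp
qed

text \<open>The bound is a fixed number outside the formula, so a finite conjunction suffices, whose
  conjuncts may differ arbitrarily with \<open>i\<close>.\<close>

lemma dfn_all_less: "(\<And>i. dfn X (P i)) \<Longrightarrow> dfn X (\<lambda>e. \<forall>i<(n::nat). P i e)"
proof (induction n)
  case 0
  then show ?case using dfn_const[of X True] by simp
next
  case (Suc n)
  then have "dfn X (\<lambda>e. (\<forall>i<n. P i e) \<and> P n e)" by (intro dfn_conj) auto
  then show ?case by (rule dfn_cong) (auto simp: less_Suc_eq)
qed

text \<open>The finite set \<open>F\<close> contains all variables on which \<open>Q a\<close>
  depends, so a variable outside \<open>F\<close> can hold the witness without changing any
  parameter.\<close>

lemma dfn_ex: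
  assumes "finite F" and Q: "\<And>k. dfn X (\<lambda>e. Q (e k) e)"
    and dep: "\<And>a e e'. (\<forall>i\<in>F. e i = e' i) \<Longrightarrow> Q a e = Q a e'"
  shows "dfn X (\<lambda>e. \<exists>a\<in>X. Q a e)"
proof -
  obtain k where k: "k \<notin> F" using assms(1) ex_new_if_finite infinite_UNIV_nat by blast
  obtain p where p: "range e \<subseteq> X \<Longrightarrow> set_sat X p e = Q (e k) e" for e
    using Q[of k] unfolding dfn_def by blast
  have "set_sat X (SEx k p) e = (\<exists>a\<in>X. Q a e)" if e: "range e \<subseteq> X" for e
  proof -
    have "set_sat X p (e(k := a)) = Q a e" if "a \<in> X" for a
    proof -
      have "set_sat X p (e(k := a)) = Q a (e(k := a))"
        using p[of "e(k := a)"] e that by auto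
      also have "\<dots> = Q a e" by (rule dep) (use k in auto)
      finally show ?thesis .
    qed
    then show ?thesis by simp
  qed
  then show ?thesis unfolding dfn_def by blast
qed

lemma dfn_all:
  assumes "finite F" and "\<And>k. dfn X (\<lambda>e. Q (e k) e)"
    and "\<And>a e e'. (\<forall>i\<in>F. e i = e' i) \<Longrightarrow> Q a e = Q a e'"
  shows "dfn X (\<lambda>e. \<forall>a\<in>X. Q a e)"
proof -
  have "dfn X (\<lambda>e. \<exists>a\<in>X. \<not> Q a e)"
    using assms by (intro dfn_ex[of F] dfn_not) blast+
  from dfn_not[OF this] show ?thesis by simp
qed

lemma dfn_ex2:
  assumes "finite F" and Q: "\<And>k l. dfn X (\<lambda>e. Q (e k) (e l) e)"
    and dep: "\<And>a b e e'. (\<forall>i\<in>F. e i = e' i) \<Longrightarrow> Q a b e = Q a b e'"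
  shows "dfn X (\<lambda>e. \<exists>a\<in>X. \<exists>b\<in>X. Q a b e)"
proof (rule dfn_ex[OF assms(1)])
  show "dfn X (\<lambda>e. \<exists>b\<in>X. Q (e k) b e)" for k
  proof (rule dfn_ex)
    show "finite (insert k F)" using assms(1) by simp
    show "Q (e k) b e = Q (e' k) b e'" if "\<forall>i\<in>insert k F. e i = e' i" for b e e'
      using dep[of e e'] that by simp
  qed (rule Q)
qed (use dep in blast)

lemma dfn_ex3:
  assumes "finite F" and Q: "\<And>k l m. dfn X (\<lambda>e. Q (e k) (e l) (e m) e)"
    and dep: "\<And>a b c e e'. (\<forall>i\<in>F. e i = e' i) \<Longrightarrow> Q a b c e = Q a b c e'"
  shows "dfn X (\<lambda>e. \<exists>a\<in>X. \<exists>b\<in>X. \<exists>c\<in>X. Q a b c e)"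
proof (rule dfn_ex[OF assms(1)])
  show "dfn X (\<lambda>e. \<exists>b\<in>X. \<exists>c\<in>X. Q (e k) b c e)" for k
  proof (rule dfn_ex2)
    show "finite (insert k F)" using assms(1) by simp
    show "Q (e k) b c e = Q (e' k) b c e'" if "\<forall>i\<in>insert k F. e i = e' i" for b c e e'
      using dep[of e e'] that by simp
  qed (rule Q)
qed (use dep in blast)

lemma dfn_all2:
  assumes "finite F" and "\<And>k l. dfn X (\<lambda>e. Q (e k) (e l) e)"
    and "\<And>a b e e'. (\<forall>i\<in>F. e i = e' i) \<Longrightarrow> Q a b e = Q a b e'"
  shows "dfn X (\<lambda>e. \<forall>a\<in>X. \<forall>b\<in>X. Q a b e)"
proof -
  have "dfn X (\<lambda>e. \<exists>a\<in>X. \<exists>b\<in>X. \<not> Q a b e)"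
    using assms by (intro dfn_ex2[of F] dfn_not) blast+
  from dfn_not[OF this] show ?thesis by simp
qed

lemma dfn_all3:
  assumes "finite F" and "\<And>k l m. dfn X (\<lambda>e. Q (e k) (e l) (e m) e)"
    and "\<And>a b c e e'. (\<forall>i\<in>F. e i = e' i) \<Longrightarrow> Q a b c e = Q a b c e'"
  shows "dfn X (\<lambda>e. \<forall>a\<in>X. \<forall>b\<in>X. \<forall>c\<in>X. Q a b c e)"
proof -
  have "dfn X (\<lambda>e. \<exists>a\<in>X. \<exists>b\<in>X. \<exists>c\<in>X. \<not> Q a b c e)"
    using assms by (intro dfn_ex3[of F] dfn_not) blast+
  from dfn_not[OF this] show ?thesis by simp
qed

text \<open>The bits beyond the end of the string coded by \<open>m\<close> count as \<open>0\<close>.\<close>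

primrec code_bit :: "nat \<Rightarrow> nat \<Rightarrow> bool" where
  "code_bit 0 m \<longleftrightarrow> (\<exists>k. m = Suc (prod_encode (1, k)))"
| "code_bit (Suc n) m \<longleftrightarrow> (\<exists>d k. m = Suc (prod_encode (d, k)) \<and> code_bit n k)"

text \<open>\<open>list_encode\<close> codes a nonempty list as the successor of the pair of its
  head and the code of its tail, so each recursive call of \<open>code_bit\<close> drops one
  entry.\<close>

lemma code_bit_str_code: "code_bit n (str_code t) \<longleftrightarrow> n < length t \<and> t ! n"
proof (induction t arbitrary: n)
  case Nil
  then show ?case by (cases n) (auto simp: str_code_def)
next
  case (Cons b t)
  then show ?case by (cases n) (auto simp: str_code_def)
qed

text \<open>This and the next two equations compute the pairing function by walking back along the
  diagonals: each step lowers the value by one and uses only successors.\<close>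

lemma prod_encode_0_0: "prod_encode (0, 0) = 0"
  by (simp add: prod_encode_def)

lemma prod_encode_Suc_left: "prod_encode (Suc i, j) = Suc (prod_encode (i, Suc j))"
  by (simp add: prod_encode_def)

lemma prod_encode_0_Suc: "prod_encode (0, Suc j) = Suc (prod_encode (j, 0))"
  by (simp add: prod_encode_def)

section \<open>Definability over transitive sets closed under adjunction\<close>

text \<open>These properties of limit levels of the constructible hierarchy already put every finite
  subset of \<open>X\<close> into \<open>X\<close>.\<close>

locale hf_closed =
  fixes X :: "'v::set_universe set"
  assumes trans: "z \<in> X \<Longrightarrow> elts z \<subseteq> X"
    and zero: "vnat 0 \<in> X"
    and vinsert_in: "a \<in> X \<Longrightarrow> b \<in> X \<Longrightarrow> vinsert a b \<in> X"
begin

lemma finite_in: "finite F \<Longrightarrow> F \<subseteq> X \<Longrightarrow> set_of F \<in> X"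
proof (induction F rule: finite_induct)
  case empty
  then show ?case using zero by (metis countable_empty elts_vnat_0 set_of_eq_iff)
next
  case (insert a F)
  then have "set_of (Set.insert a F) = vinsert a (set_of F)"
    by (intro extensionality) (simp add: countable_finite)
  then show ?case using insert vinsert_in by simp
qed

lemma vnat_in: "vnat n \<in> X"
  by (induction n) (auto intro: zero vinsert_in)

lemma vpair_in: "a \<in> X \<Longrightarrow> b \<in> X \<Longrightarrow> vpair a b \<in> X"
  unfolding vpair_def by (simp add: finite_in)

text \<open>Here and below, transitivity of \<open>X\<close> ensures that quantifiers restricted to
  \<open>X\<close> still see all elements of the sets in question.\<close>

lemma dfn_zero: "dfn X (\<lambda>e. e i = vnat 0)"
proof (rule dfn_cong)
  show "dfn X (\<lambda>e. \<forall>a\<in>X. a \<notin> elts (e i))"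
    by (intro dfn_all[of "{i}"] dfn_not dfn_mem) auto
  show "(\<forall>a\<in>X. a \<notin> elts (e i)) = (e i = vnat 0)" if "range e \<subseteq> X" for e
    using trans[of "e i"] that by (auto simp: eq_vnat_0_iff)
qed

lemma dfn_succ: "dfn X (\<lambda>e. e i = vsucc (e j))"
proof (rule dfn_cong)
  show "dfn X (\<lambda>e. \<forall>a\<in>X. a \<in> elts (e i) \<longleftrightarrow> a = e j \<or> a \<in> elts (e j))"
    by (intro dfn_all[of "{i, j}"] dfn_iff dfn_mem dfn_disj dfn_eq) auto
  show "(\<forall>a\<in>X. a \<in> elts (e i) \<longleftrightarrow> a = e j \<or> a \<in> elts (e j)) = (e i = vsucc (e j))"
    if "range e \<subseteq> X" for e
  proof -
    have "e i = vsucc (e j) \<longleftrightarrow> elts (e i) = Set.insert (e j) (elts (e j))"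
      using elts_vinsert extensionality by metis
    moreover have "elts (e i) \<subseteq> X" "elts (e j) \<subseteq> X" "e j \<in> X"
      using trans[of "e i"] trans[of "e j"] that by auto
    ultimately show ?thesis by blast
  qed
qed

lemma dfn_doubleton: "dfn X (\<lambda>e. e i = set_of {e j, e k})"
proof (rule dfn_cong)
  show "dfn X (\<lambda>e. \<forall>a\<in>X. a \<in> elts (e i) \<longleftrightarrow> a = e j \<or> a = e k)"
    by (intro dfn_all[of "{i, j, k}"] dfn_iff dfn_mem dfn_disj dfn_eq) auto
  show "(\<forall>a\<in>X. a \<in> elts (e i) \<longleftrightarrow> a = e j \<or> a = e k) = (e i = set_of {e j, e k})"
    if "range e \<subseteq> X" for e
  proof -
    have "elts (e i) \<subseteq> X" "e j \<in> X" "e k \<in> X" using trans[of "e i"] that by auto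
    then show ?thesis by (auto simp: set_of_eq_iff)
  qed
qed

lemma dfn_pair: "dfn X (\<lambda>e. e i = vpair (e j) (e k))"
proof (rule dfn_cong)
  \<comment> \<open>The singleton is written as an unordered pair so that
    \<open>dfn_doubleton\<close> handles all three sets.\<close>
  show "dfn X (\<lambda>e. \<exists>a\<in>X. \<exists>b\<in>X. a = set_of {e j, e j} \<and> b = set_of {e j, e k} \<and>
      e i = set_of {a, b})"
    by (intro dfn_ex2[of "{i, j, k}"] dfn_conj dfn_doubleton) auto
  show "(\<exists>a\<in>X. \<exists>b\<in>X. a = set_of {e j, e j} \<and> b = set_of {e j, e k} \<and> e i = set_of {a, b}) =
      (e i = vpair (e j) (e k))" if "range e \<subseteq> X" for e
    using finite_in[of "{e j}"] finite_in[of "{e j, e k}"] that by (auto simp: vpair_def)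
qed

lemma dfn_pair_mem: "dfn X (\<lambda>e. vpair (e i) (e j) \<in> elts (e f))"
proof (rule dfn_cong)
  show "dfn X (\<lambda>e. \<exists>t\<in>X. t = vpair (e i) (e j) \<and> t \<in> elts (e f))"
    by (intro dfn_ex[of "{i, j, f}"] dfn_conj dfn_pair dfn_mem) auto
  show "(\<exists>t\<in>X. t = vpair (e i) (e j) \<and> t \<in> elts (e f)) = (vpair (e i) (e j) \<in> elts (e f))"
    if "range e \<subseteq> X" for e
    using trans[of "e f"] that by auto
qed

lemma dfn_triple_mem: "dfn X (\<lambda>e. vpair (e i) (vpair (e j) (e k)) \<in> elts (e f))"
proof (rule dfn_cong)
  show "dfn X (\<lambda>e. \<exists>t\<in>X. t = vpair (e j) (e k) \<and> vpair (e i) t \<in> elts (e f))"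
    by (intro dfn_ex[of "{i, j, k, f}"] dfn_conj dfn_pair dfn_pair_mem) auto
  show "(\<exists>t\<in>X. t = vpair (e j) (e k) \<and> vpair (e i) t \<in> elts (e f)) =
      (vpair (e i) (vpair (e j) (e k)) \<in> elts (e f))"
    if "range e \<subseteq> X" for e
    using vpair_in[of "e j" "e k"] that by auto
qed

section \<open>The graph of the pairing function\<close>

text \<open>The successor of \<open>b\<close> gets the name \<open>b'\<close> because definability
  is stated for values of variables only. In the last case \<open>a\<close>, being zero, also serves
  as the second component of the earlier pair.\<close>

definition prod_step :: "'v \<Rightarrow> 'v \<Rightarrow> 'v \<Rightarrow> 'v \<Rightarrow> bool" where
  "prod_step f a b c \<longleftrightarrow>
     a = vnat 0 \<and> b = vnat 0 \<and> c = vnat 0 \<or>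
     (\<exists>a'\<in>X. \<exists>b'\<in>X. \<exists>c'\<in>X. a = vsucc a' \<and> b' = vsucc b \<and> c = vsucc c' \<and>
        vpair a' (vpair b' c') \<in> elts f) \<or>
     (\<exists>b'\<in>X. \<exists>c'\<in>X. a = vnat 0 \<and> b = vsucc b' \<and> c = vsucc c' \<and>
        vpair b' (vpair a c') \<in> elts f)"

definition prod_closed :: "'v \<Rightarrow> bool" where
  "prod_closed f \<longleftrightarrow> (\<forall>a\<in>X. \<forall>b\<in>X. \<forall>c\<in>X. vpair a (vpair b c) \<in> elts f \<longrightarrow> prod_step f a b c)"

lemma dfn_prod_closed: "dfn X (\<lambda>e. prod_closed (e f))"
proof -
  have "dfn X (\<lambda>e. prod_step (e f) (e a) (e b) (e c))" for f a b c
    unfolding prod_step_def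
    by (intro dfn_disj dfn_conj dfn_zero dfn_ex3[of "{f, a, b, c}"] dfn_ex2[of "{f, a, b, c}"]
        dfn_succ dfn_triple_mem) auto
  then show ?thesis
    unfolding prod_closed_def
    by (intro dfn_all3[of "{f}"] dfn_imp dfn_triple_mem) auto
qed

text \<open>Membership induction on the value \<open>c\<close>: both recursive cases pass to its
  predecessor, which is an element of \<open>c\<close>.\<close>

lemma prod_closed_sound:
  assumes f: "f \<in> X" "prod_closed f"
  shows "vpair a (vpair b c) \<in> elts f \<Longrightarrow>
    \<exists>i j. a = vnat i \<and> b = vnat j \<and> c = vnat (prod_encode (i, j))"
proof (induction c arbitrary: a b rule: wf_induct_rule[OF foundation])
  case (1 c)
  have "vpair b c \<in> X" "a \<in> X" "b \<in> X" "c \<in> X"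
  proof -
    have *: "x \<in> X \<and> y \<in> X" if "vpair x y \<in> X" for x y
    proof -
      have "set_of {x, y} \<in> X" using trans[OF that] by (simp add: vpair_def)
      from trans[OF this] show ?thesis by simp
    qed
    have "vpair a (vpair b c) \<in> X" using 1(2) trans[OF f(1)] by blast
    then show "vpair b c \<in> X" "a \<in> X" "b \<in> X" "c \<in> X" using * by blast+
  qed
  then have "prod_step f a b c" using f(2) 1(2) unfolding prod_closed_def by blast
  then consider "a = vnat 0" "b = vnat 0" "c = vnat 0"
    | a' c' where "a = vsucc a'" "c = vsucc c'" "vpair a' (vpair (vsucc b) c') \<in> elts f"
    | b' c' where "a = vnat 0" "b = vsucc b'" "c = vsucc c'" "vpair b' (vpair (vnat 0) c') \<in> elts f"
    unfolding prod_step_def by blast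
  then show ?case
  proof cases
    case 1
    then show ?thesis using prod_encode_0_0 by metis
  next
    case 2
    then have "c' \<in> elts c" by simp
    with 2 1(1)[of c' a' "vsucc b"] obtain i j where
      ij: "a' = vnat i" "vsucc b = vnat j" "c' = vnat (prod_encode (i, j))" by auto
    \<comment> \<open>The induction hypothesis speaks of the successor of \<open>b\<close>; its
      being a numeral makes \<open>b\<close> one.\<close>
    obtain k where "j = Suc k" "b = vnat k" using ij(2) by (rule vsucc_eq_vnatE)
    then have "a = vnat (Suc i) \<and> b = vnat k \<and> c = vnat (prod_encode (Suc i, k))"
      using 2 ij by (simp add: prod_encode_Suc_left)
    then show ?thesis by blast
  next
    case 3
    then have "c' \<in> elts c" by simp
    with 3 1(1)[of c' b' "vnat 0"] obtain i where
      "b' = vnat i" "c' = vnat (prod_encode (i, 0))" by auto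
    then have "a = vnat 0 \<and> b = vnat (Suc i) \<and> c = vnat (prod_encode (0, Suc i))"
      using 3 by (simp add: prod_encode_0_Suc)
    then show ?thesis by blast
  qed
qed

text \<open>The triples whose value is at most \<open>prod_encode (i, j)\<close> form a finite set,
  which is closed backwards because the recursion lowers the value.\<close>

lemma prod_closed_exists:
  "\<exists>f\<in>X. prod_closed f \<and> vpair (vnat i) (vpair (vnat j) (vnat (prod_encode (i, j)))) \<in> elts f"
proof -
  define t where "t n = (case prod_decode n of (i, j) \<Rightarrow> vpair (vnat i) (vpair (vnat j) (vnat n) :: 'v))" for n
  have t: "t (prod_encode (i, j)) = vpair (vnat i) (vpair (vnat j) (vnat (prod_encode (i, j))))"
    for i j by (simp add: t_def)
  define f :: 'v where "f = set_of (t ` {..prod_encode (i, j)})"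
  have "t n \<in> X" for n
    by (auto simp: t_def vpair_in vnat_in split: prod.split)
  then have "f \<in> X" unfolding f_def by (intro finite_in) auto
  have f: "elts f = t ` {..prod_encode (i, j)}" by (simp add: f_def)
  have mem: "vpair (vnat k) (vpair (vnat l) (vnat (prod_encode (k, l)))) \<in> elts f"
    if "prod_encode (k, l) \<le> prod_encode (i, j)" for k l
    using t[of k l] that f by (metis atMost_iff imageI)
  have "prod_closed f"
    unfolding prod_closed_def
  proof (intro ballI impI)
    fix a b c assume "vpair a (vpair b c) \<in> elts f"
    then obtain n where n: "n \<le> prod_encode (i, j)" "vpair a (vpair b c) = t n"
      using f by auto
    obtain k l where "n = prod_encode (k, l)" by (metis prod_decode_inverse surj_pair)
    with n have kl: "a = vnat k" "b = vnat l" "c = vnat (prod_encode (k, l))"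
      "prod_encode (k, l) \<le> prod_encode (i, j)" by (simp_all add: t)
    show "prod_step f a b c"
    proof (cases k)
      case (Suc k')
      with kl mem[of k' "Suc l"] have "a = vsucc (vnat k')" "c = vsucc (vnat (prod_encode (k', Suc l)))"
        "vpair (vnat k') (vpair (vsucc b) (vnat (prod_encode (k', Suc l)))) \<in> elts f"
        by (simp_all add: prod_encode_Suc_left)
      moreover have "vsucc b \<in> X" using kl(2) vnat_in[of "Suc l"] by simp
      ultimately show ?thesis unfolding prod_step_def using vnat_in by blast
    next
      case 0
      show ?thesis
      proof (cases l)
        case 0
        then show ?thesis using kl \<open>k = 0\<close> prod_encode_0_0 by (simp add: prod_step_def)
      next
        case (Suc l')
        with 0 kl mem[of l' 0] have "a = vnat 0" "b = vsucc (vnat l')"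
          "c = vsucc (vnat (prod_encode (l', 0)))"
          "vpair (vnat l') (vpair a (vnat (prod_encode (l', 0)))) \<in> elts f"
          by (simp_all add: prod_encode_0_Suc)
        then show ?thesis unfolding prod_step_def using vnat_in by blast
      qed
    qed
  qed
  with \<open>f \<in> X\<close> show ?thesis using mem[of i j] by blast
qed

definition prod_graph :: "'v \<Rightarrow> 'v \<Rightarrow> 'v \<Rightarrow> bool" where
  "prod_graph a b c \<longleftrightarrow> (\<exists>i j. a = vnat i \<and> b = vnat j \<and> c = vnat (prod_encode (i, j)))"

lemma dfn_prod_graph: "dfn X (\<lambda>e. prod_graph (e a) (e b) (e c))"
proof (rule dfn_cong)
  show "dfn X (\<lambda>e. \<exists>f\<in>X. prod_closed f \<and> vpair (e a) (vpair (e b) (e c)) \<in> elts f)"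
    by (intro dfn_ex[of "{a, b, c}"] dfn_conj dfn_prod_closed dfn_triple_mem) auto
  show "(\<exists>f\<in>X. prod_closed f \<and> vpair (e a) (vpair (e b) (e c)) \<in> elts f) =
      prod_graph (e a) (e b) (e c)" for e
    using prod_closed_sound prod_closed_exists unfolding prod_graph_def by metis
qed

section \<open>The bits of string codes\<close>

text \<open>In the base case \<open>n\<close> is zero, so \<open>d\<close> is the numeral 1 required
  as the first entry. In the other case the first entry is arbitrary and gets dropped.\<close>

definition bit_step :: "'v \<Rightarrow> 'v \<Rightarrow> 'v \<Rightarrow> bool" where
  "bit_step f n m \<longleftrightarrow>
     n = vnat 0 \<and> (\<exists>k\<in>X. \<exists>d\<in>X. \<exists>l\<in>X. m = vsucc l \<and> d = vsucc n \<and> prod_graph d k l) \<or>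
     (\<exists>n'\<in>X. n = vsucc n' \<and>
       (\<exists>k\<in>X. \<exists>d\<in>X. \<exists>l\<in>X. m = vsucc l \<and> prod_graph d k l \<and> vpair n' k \<in> elts f))"

definition bit_closed :: "'v \<Rightarrow> bool" where
  "bit_closed f \<longleftrightarrow> (\<forall>n\<in>X. \<forall>m\<in>X. vpair n m \<in> elts f \<longrightarrow> bit_step f n m)"

lemma dfn_bit_closed: "dfn X (\<lambda>e. bit_closed (e f))"
proof -
  have suc: "dfn X (\<lambda>e. \<exists>k\<in>X. \<exists>d\<in>X. \<exists>l\<in>X. e m = vsucc l \<and> prod_graph d k l \<and>
      vpair (e n') k \<in> elts (e f))" for m n' f
    by (intro dfn_ex3[of "{m, n', f}"] dfn_conj dfn_succ dfn_prod_graph dfn_pair_mem) auto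
  have "dfn X (\<lambda>e. \<exists>n'\<in>X. e n = vsucc n' \<and> (\<exists>k\<in>X. \<exists>d\<in>X. \<exists>l\<in>X. e m = vsucc l \<and>
      prod_graph d k l \<and> vpair n' k \<in> elts (e f)))" for f n m
  proof (rule dfn_ex[of "{f, n, m}"])
    show "dfn X (\<lambda>e. e n = vsucc (e n') \<and> (\<exists>k\<in>X. \<exists>d\<in>X. \<exists>l\<in>X. e m = vsucc l \<and>
        prod_graph d k l \<and> vpair (e n') k \<in> elts (e f)))" for n'
      by (rule dfn_conj[OF dfn_succ suc])
  qed auto
  moreover have "dfn X (\<lambda>e. \<exists>k\<in>X. \<exists>d\<in>X. \<exists>l\<in>X. e m = vsucc l \<and> d = vsucc (e n) \<and>
      prod_graph d k l)" for n m
    by (intro dfn_ex3[of "{n, m}"] dfn_conj dfn_succ dfn_prod_graph) auto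
  ultimately have "dfn X (\<lambda>e. bit_step (e f) (e n) (e m))" for f n m
    unfolding bit_step_def by (intro dfn_disj dfn_conj dfn_zero)
  then show ?thesis
    unfolding bit_closed_def
    by (intro dfn_all2[of "{f}"] dfn_imp dfn_pair_mem) auto
qed

text \<open>This time the induction is on the position \<open>n\<close>, which drops to its
  predecessor; the pairing graph forces the code \<open>m\<close> to be a numeral.\<close>

lemma bit_closed_sound:
  assumes f: "f \<in> X" "bit_closed f"
  shows "vpair n m \<in> elts f \<Longrightarrow> \<exists>i j. n = vnat i \<and> m = vnat j \<and> code_bit i j"
proof (induction n arbitrary: m rule: wf_induct_rule[OF foundation])
  case (1 n)
  have "n \<in> X" "m \<in> X"
  proof -
    have "vpair n m \<in> X" using 1(2) trans[OF f(1)] by blast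
    then have "set_of {n, m} \<in> X" using trans[of "vpair n m"] by (simp add: vpair_def)
    from trans[OF this] show "n \<in> X" "m \<in> X" by simp_all
  qed
  then have "bit_step f n m" using f(2) 1(2) unfolding bit_closed_def by blast
  then consider k l where "n = vnat 0" "m = vsucc l" "prod_graph (vsucc (vnat 0)) k l"
    | n' k d l where "n = vsucc n'" "m = vsucc l" "prod_graph d k l" "vpair n' k \<in> elts f"
    unfolding bit_step_def by blast
  then show ?case
  proof cases
    case 1
    then obtain i j where ij: "vnat (Suc 0) = (vnat i :: 'v)" "l = vnat (prod_encode (i, j))"
      unfolding prod_graph_def by auto
    then have "i = 1" by (simp del: vnat_Suc)
    then have "m = vnat (Suc (prod_encode (1, j)))" "code_bit 0 (Suc (prod_encode (1, j)))"
      using 1 ij by auto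
    then show ?thesis using 1 by blast
  next
    case 2
    then have "n' \<in> elts n" by simp
    with 2 1(1)[of n' k] obtain i j where
      ij: "n' = vnat i" "k = vnat j" "code_bit i j" by auto
    obtain d' where "l = vnat (prod_encode (d', j))"
      using 2(3) ij unfolding prod_graph_def by auto
    then have "n = vnat (Suc i) \<and> m = vnat (Suc (prod_encode (d', j)))
        \<and> code_bit (Suc i) (Suc (prod_encode (d', j)))"
      using 2 ij by auto
    then show ?thesis by blast
  qed
qed

text \<open>The correct pairs with position at most \<open>i\<close> and code at most
  \<open>j\<close> are closed backwards, as a tail has a smaller code.\<close>

lemma bit_closed_exists:
  assumes "code_bit i j"
  shows "\<exists>f\<in>X. bit_closed f \<and> vpair (vnat i) (vnat j) \<in> elts f"
proof -
  define I where "I = {(n, m). n \<le> i \<and> m \<le> j \<and> code_bit n m}"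
  have "I \<subseteq> {..i} \<times> {..j}" by (auto simp: I_def)
  then have fin: "finite I" by (rule finite_subset) simp
  define f :: 'v where "f = set_of ((\<lambda>(n, m). vpair (vnat n) (vnat m)) ` I)"
  have "f \<in> X" unfolding f_def using fin by (intro finite_in) (auto simp: vpair_in vnat_in)
  have f: "elts f = (\<lambda>(n, m). vpair (vnat n) (vnat m)) ` I"
    using fin by (simp add: f_def countable_finite)
  have "bit_closed f"
    unfolding bit_closed_def
  proof (intro ballI impI)
    fix a b assume "vpair a b \<in> elts f"
    then obtain n m where nm: "a = vnat n" "b = vnat m" "n \<le> i" "m \<le> j" "code_bit n m"
      using f by (auto simp: I_def)
    show "bit_step f a b"
    proof (cases n)
      case 0
      then obtain k where "m = Suc (prod_encode (1, k))" using nm by auto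
      then have "b = vsucc (vnat (prod_encode (1, k)))"
        "prod_graph (vnat (Suc 0)) (vnat k) (vnat (prod_encode (1, k)))"
        using nm unfolding prod_graph_def by (auto simp del: vnat_Suc(1) simp: vnat_Suc)
      then show ?thesis
        unfolding bit_step_def using 0 nm(1) vnat_in vnat_Suc by blast
    next
      case (Suc n')
      then obtain d k where m: "m = Suc (prod_encode (d, k))" "code_bit n' k" using nm by auto
      moreover have "k \<le> j" using le_prod_encode_2[of k d] m nm(4) by linarith
      ultimately have "(n', k) \<in> I" using Suc nm by (auto simp: I_def)
      then have "vpair (vnat n') (vnat k) \<in> elts f" using f by (auto intro: rev_image_eqI)
      moreover have "b = vsucc (vnat (prod_encode (d, k)))" "a = vsucc (vnat n')"
        using m nm Suc by auto
      moreover have "prod_graph (vnat d) (vnat k) (vnat (prod_encode (d, k)))"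
        unfolding prod_graph_def by blast
      ultimately show ?thesis unfolding bit_step_def using vnat_in by blast
    qed
  qed
  moreover have "vpair (vnat i) (vnat j) \<in> elts f"
    using assms unfolding f by (intro rev_image_eqI[of "(i, j)"]) (auto simp: I_def)
  ultimately show ?thesis using \<open>f \<in> X\<close> by blast
qed

definition bit_graph :: "'v \<Rightarrow> 'v \<Rightarrow> bool" where
  "bit_graph n m \<longleftrightarrow> (\<exists>i j. n = vnat i \<and> m = vnat j \<and> code_bit i j)"

lemma dfn_bit_graph: "dfn X (\<lambda>e. bit_graph (e n) (e m))"
proof (rule dfn_cong)
  show "dfn X (\<lambda>e. \<exists>f\<in>X. bit_closed f \<and> vpair (e n) (e m) \<in> elts f)"
    by (intro dfn_ex[of "{n, m}"] dfn_conj dfn_bit_closed dfn_pair_mem) auto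
  show "(\<exists>f\<in>X. bit_closed f \<and> vpair (e n) (e m) \<in> elts f) = bit_graph (e n) (e m)" for e
    using bit_closed_sound bit_closed_exists unfolding bit_graph_def by metis
qed

text \<open>The real \<open>x\<close> need not be represented in \<open>X\<close>: only its first
  \<open>l\<close> bits enter, each as a constant truth value. The parameters are \<open>v\<close>
  and numerals.\<close>

lemma branch_in_Def:
  assumes v: "v \<in> X" "elts v = vnat ` c"
  shows "\<exists>w\<in>Def X. elts w = vnat `
    {n. \<exists>m. code_bit n m \<and> prod_encode (m, q) \<in> c \<and> (\<forall>i<l. code_bit i m \<longleftrightarrow> x i)}"
    (is "\<exists>w\<in>_. _ = vnat ` ?Y")
proof -
  \<comment> \<open>Variable 0 is left for the element under definition, 1 holds the code, 2 the
    number \<open>q\<close>, and \<open>i + 3\<close> the position \<open>i\<close>. Truncated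
    subtraction puts a numeral at 0, to be overwritten.\<close>
  define e :: "nat \<Rightarrow> 'v" where
    "e i = (if i = 1 then v else if i = 2 then vnat q else vnat (i - 3))" for i
  have e: "range e \<subseteq> X" using v vnat_in by (auto simp: e_def)
  define Q :: "(nat \<Rightarrow> 'v) \<Rightarrow> bool" where
    "Q e \<longleftrightarrow> (\<exists>m\<in>X. \<exists>z\<in>X. bit_graph (e 0) m \<and> prod_graph m (e 2) z \<and> z \<in> elts (e 1) \<and>
       (\<forall>i<l. bit_graph (e (i + 3)) m \<longleftrightarrow> x i))" for e
  have "dfn X Q"
    unfolding Q_def
    by (intro dfn_ex2[of "{..l + 3}"] dfn_conj dfn_bit_graph dfn_prod_graph dfn_mem
        dfn_all_less dfn_iff dfn_const) auto
  then obtain p where p: "range e \<subseteq> X \<Longrightarrow> set_sat X p e = Q e" for e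
    unfolding dfn_def by blast
  have "{a \<in> X. set_sat X p (e(0 := a))} = vnat ` ?Y"
  proof (intro set_eqI iffI)
    fix a assume "a \<in> {a \<in> X. set_sat X p (e(0 := a))}"
    then have "Q (e(0 := a))" using p[of "e(0 := a)"] e by auto
    then obtain m z where mz: "bit_graph a m" "prod_graph m (vnat q) z" "z \<in> elts v"
      "\<forall>i<l. bit_graph (vnat i) m \<longleftrightarrow> x i"
      unfolding Q_def by (auto simp: e_def)
    then show "a \<in> vnat ` ?Y"
      using v(2) unfolding bit_graph_def prod_graph_def by (auto intro!: imageI)
  next
    fix a :: 'v assume "a \<in> vnat ` ?Y"
    then obtain n m where nm: "a = vnat n" "code_bit n m" "prod_encode (m, q) \<in> c"
      "\<forall>i<l. code_bit i m \<longleftrightarrow> x i" by blast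
    have "bit_graph a (vnat m)" "prod_graph (vnat m) (vnat q) (vnat (prod_encode (m, q)))"
      "vnat (prod_encode (m, q)) \<in> elts v" "\<forall>i<l. bit_graph (vnat i) (vnat m) \<longleftrightarrow> x i"
      using nm v(2) by (auto simp: bit_graph_def prod_graph_def)
    then have "Q (e(0 := a))"
      unfolding Q_def using vnat_in[of m] vnat_in[of "prod_encode (m, q)"]
      by (intro bexI[of _ "vnat m"] bexI[of _ "vnat (prod_encode (m, q))"]) (simp_all add: e_def)
    moreover have "a \<in> X" using nm(1) vnat_in by simp
    ultimately show "a \<in> {a \<in> X. set_sat X p (e(0 := a))}" using p[of "e(0 := a)"] e by auto
  qed
  moreover have "elts (set_of (vnat ` ?Y) :: 'v) = vnat ` ?Y" by simp
  moreover have "e ` (set_fv p - {0}) \<subseteq> X" using e by blast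
  ultimately have "set_of (vnat ` ?Y) \<in> Def X"
    unfolding Def_def by (intro CollectI exI[of _ p] exI[of _ e]) simp
  then show ?thesis by (intro bexI[of _ "set_of (vnat ` ?Y)"]) auto
qed

end

section \<open>The constructible reals\<close>

lemma Lset_mono: "elts a \<subseteq> elts b \<Longrightarrow> Lset a \<subseteq> Lset b"
  by (subst (1 2) Lset.simps) blast

lemma Def_subset_Lset: "b \<in> elts a \<Longrightarrow> Def (Lset b) \<subseteq> Lset a"
  by (subst (2) Lset.simps) blast

text \<open>An element of \<open>Lset a\<close> is a subset of \<open>Lset b\<close> for some
  \<open>b\<close> in \<open>a\<close>, and \<open>b\<close> is included in \<open>a\<close> because
  \<open>a\<close> is an ordinal.\<close>

lemma Lset_transitive:
  assumes "Ord a" "x \<in> Lset a"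
  shows "elts x \<subseteq> Lset a"
proof -
  obtain b where b: "b \<in> elts a" "x \<in> Def (Lset b)"
    using assms(2) by (subst (asm) Lset.simps) blast
  then have "elts x \<subseteq> Lset b" by (auto simp: Def_def)
  also have "\<dots> \<subseteq> Lset a" using assms(1) b(1) by (intro Lset_mono) (auto simp: Ord_def)
  finally show ?thesis .
qed

lemma Ord_vsucc: "Ord a \<Longrightarrow> Ord (vsucc a)"
  unfolding Ord_def by auto

lemma zero_in_Def: "vnat 0 \<in> Def X"
  \<comment> \<open>Only variable 0 occurs, so no parameter has to be found in \<open>X\<close>,
    which may be empty.\<close>
  unfolding Def_def by (intro CollectI exI[of _ "SNeg (SEq 0 0)"]) simp

lemma vinsert_in_Def:
  assumes "a \<in> X" "b \<in> X" "elts b \<subseteq> X"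
  shows "vinsert a b \<in> Def X"
proof -
  \<comment> \<open>The formula is the disjunction of \<open>x = a\<close> and
    \<open>x \<in> b\<close>, written with negation and conjunction. All elements of
    \<open>b\<close> lie in \<open>X\<close>, so restricting to \<open>X\<close> loses none.\<close>
  have "elts (vinsert a b) = {x \<in> X. set_sat X (SNeg (SConj (SNeg (SEq 0 1)) (SNeg (SMem 0 2))))
      ((\<lambda>i. if i = 1 then a else b)(0 := x))}"
    using assms by auto
  then show ?thesis
    unfolding Def_def
    by (intro CollectI exI[of _ "SNeg (SConj (SNeg (SEq 0 1)) (SNeg (SMem 0 2)))"]
        exI[of _ "\<lambda>i. if i = 1 then a else b"] conjI) (use assms in auto)
qed

text \<open>The limit of the finite successors of \<open>a\<close> works: two elements of its level
  occur together in some \<open>Lset (s n)\<close>, and their adjunction is definable over that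
  level.\<close>

lemma Lset_hf_closed:
  assumes a: "Ord (a :: 'v::set_universe)"
  obtains l where "Ord l" "Lset a \<subseteq> Lset l" "hf_closed (Lset l)"
proof -
  define s where "s n = (vsucc ^^ n) a" for n
  have s: "s 0 = a" "s (Suc n) = vsucc (s n)" for n by (simp_all add: s_def)
  have Ord_s: "Ord (s n)" for n by (induction n) (simp_all add: s a Ord_vsucc)
  define l where "l = set_of (\<Union>n. elts (s n))"
  have "(\<Union>n. elts (s n)) \<in> range elts"
    using union[OF countable_in_range_elts, of "range s"] by simp
  then have l: "elts l = (\<Union>n. elts (s n))" by (simp add: l_def elts_set_of)
  have Ord_l: "Ord l" using Ord_s by (fastforce simp: Ord_def l)
  have up: "Lset (s n) \<subseteq> Lset l" for n by (rule Lset_mono) (auto simp: l)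
  have Def_s: "Def (Lset (s n)) \<subseteq> Lset (s (Suc n))" for n
    by (rule Def_subset_Lset) (simp add: s)
  have mono: "Lset (s m) \<subseteq> Lset (s n)" if "m \<le> n" for m n
    using that by (rule lift_Suc_mono_le[rotated]) (auto simp: s intro!: Lset_mono)
  have down: "\<exists>n. x \<in> Lset (s n)" if "x \<in> Lset l" for x
  proof -
    obtain b where "b \<in> elts l" "x \<in> Def (Lset b)"
      using \<open>x \<in> Lset l\<close> by (subst (asm) Lset.simps) blast
    then show ?thesis using l Def_subset_Lset by blast
  qed
  have "hf_closed (Lset l)"
  proof
    show "elts z \<subseteq> Lset l" if "z \<in> Lset l" for z
      using Lset_transitive[OF Ord_l that] .
    show "vnat 0 \<in> Lset l" using zero_in_Def Def_s up by blast
    show "vinsert x y \<in> Lset l" if xy: "x \<in> Lset l" "y \<in> Lset l" for x y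
    proof -
      obtain m n where "x \<in> Lset (s m)" "y \<in> Lset (s n)" using xy down by blast
      then have "x \<in> Lset (s (max m n))" "y \<in> Lset (s (max m n))"
        using mono[of m "max m n"] mono[of n "max m n"] by auto
      then have "vinsert x y \<in> Def (Lset (s (max m n)))"
        by (intro vinsert_in_Def Lset_transitive Ord_s)
      then show ?thesis using Def_s up by blast
    qed
  qed
  moreover have "Lset a \<subseteq> Lset l" using up[of 0] s by simp
  ultimately show thesis using that Ord_l by blast
qed

text \<open>The code lies in a limit level, over which \<open>branch_in_Def\<close> defines the
  branch; so the branch appears one level later.\<close>

lemma L_reals_branch:
  assumes "c \<in> L_reals TYPE('v::set_universe)"
  shows "{n. \<exists>m. code_bit n m \<and> prod_encode (m, q) \<in> c \<and> (\<forall>i<l. code_bit i m \<longleftrightarrow> x i)}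
    \<in> L_reals TYPE('v)"
proof -
  obtain v :: 'v and a where v: "elts v = vnat ` c" "Ord a" "v \<in> Lset a"
    using assms unfolding L_reals_def L_class_def by auto
  obtain b where b: "Ord b" "Lset a \<subseteq> Lset b" "hf_closed (Lset b)"
    using Lset_hf_closed[OF v(2)] by blast
  have "v \<in> Lset b" using v(3) b(2) by blast
  from hf_closed.branch_in_Def[OF b(3) this v(1), of q l x]
  obtain w where w: "w \<in> Def (Lset b)" "elts w = vnat `
      {n. \<exists>m. code_bit n m \<and> prod_encode (m, q) \<in> c \<and> (\<forall>i<l. code_bit i m \<longleftrightarrow> x i)}"
    by blast
  have "w \<in> Lset (vsucc b)" using w(1) Def_subset_Lset[of b "vsucc b"] by auto
  then have "w \<in> L_class" using Ord_vsucc[OF b(1)] unfolding L_class_def by blast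
  then show ?thesis unfolding L_reals_def using w(2) by blast
qed

section \<open>Atoms of measures\<close>

lemma cyl_in_borel: "cyl s \<in> sets borel"
proof -
  have "closed {x :: cantor. x i = b}" for i b
  proof -
    have "continuous_on UNIV (\<lambda>x :: cantor. x i)" by (rule continuous_on_product_coordinates)
    then show ?thesis using closed_Collect_eq[of "\<lambda>x. x i" "\<lambda>_. b"] by simp
  qed
  moreover have "cyl s = (\<Inter>i\<in>{..<length s}. {x. x i = s ! i})" by (auto simp: cyl_def)
  ultimately show ?thesis by (intro borel_closed) (auto intro: closed_INT)
qed

lemma mem_cyl_map_upt: "y \<in> cyl (map x [0..<n]) \<longleftrightarrow> (\<forall>i<n. y i = x i)"
  by (simp add: cyl_def)

lemma Inter_cyl: "(\<Inter>n. cyl (map x [0..<n])) = {x}"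
proof (intro set_eqI iffI)
  fix y assume y: "y \<in> (\<Inter>n. cyl (map x [0..<n]))"
  have "y i = x i" for i
  proof -
    have "y \<in> cyl (map x [0..<Suc i])" using y by blast
    then show ?thesis unfolding mem_cyl_map_upt by blast
  qed
  then show "y \<in> {x}" by (simp add: fun_eq_iff)
qed (simp add: mem_cyl_map_upt)

lemma singleton_in_borel: "{x :: cantor} \<in> sets borel"
  unfolding Inter_cyl[symmetric] using cyl_in_borel by blast

text \<open>The set has the form treated by \<open>L_reals_branch\<close>, so an atom of a measure
  with constructible code is constructible.\<close>

lemma atom_definable:
  assumes "\<mu> \<in> P_cantor" and pos: "measure \<mu> {x} > 0"
  obtains q l where "{n. x n} =
    {n. \<exists>m. code_bit n m \<and> prod_encode (m, q) \<in> measure_code \<mu> \<and> (\<forall>i<l. code_bit i m \<longleftrightarrow> x i)}"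
proof -
  interpret prob_space \<mu> using assms(1) by (simp add: P_cantor_def)
  have sets: "cyl s \<in> sets \<mu>" "{x} \<in> sets \<mu>" for s
    using assms(1) cyl_in_borel singleton_in_borel by (auto simp: P_cantor_def)
  define N where "N n = cyl (map x [0..<n])" for n
  have N: "x \<in> N n" "N n \<in> sets \<mu>" for n using sets by (auto simp: N_def mem_cyl_map_upt)
  have "(\<lambda>n. measure \<mu> (N n)) \<longlonglongrightarrow> measure \<mu> (\<Inter>n. N n)"
    by (rule finite_Lim_measure_decseq) (use N in \<open>auto simp: N_def decseq_def mem_cyl_map_upt\<close>)
  then have "(\<lambda>n. measure \<mu> (N n)) \<longlonglongrightarrow> measure \<mu> {x}" by (simp add: N_def Inter_cyl)
  \<comment> \<open>The factor 2 makes the rest of \<open>N l\<close> lighter than the atom, which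
    leaves room for a rational \<open>r\<close> strictly between the two masses.\<close>
  then have "\<forall>\<^sub>F n in sequentially. measure \<mu> (N n) < 2 * measure \<mu> {x}"
    by (rule order_tendstoD) (use pos in simp)
  then obtain l where l: "measure \<mu> (N l) < 2 * measure \<mu> {x}"
    by (auto simp: eventually_sequentially)
  have "measure \<mu> (N l) - measure \<mu> {x} < measure \<mu> {x}" using l by simp
  then obtain r where r: "r \<in> \<rat>" "measure \<mu> (N l) - measure \<mu> {x} < r" "r < measure \<mu> {x}"
    using Rats_dense_in_real by blast
  \<comment> \<open>The cuts record only nonnegative rationals, so the sign of \<open>r\<close> has
    to be settled before \<open>r\<close> is written as a fraction of naturals.\<close>
  have "measure \<mu> {x} \<le> measure \<mu> (N l)" using N by (intro finite_measure_mono) auto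
  then have "r > 0" using r(2) by simp
  obtain a b where ab: "b \<noteq> 0" "\<bar>r\<bar> = real a / real b"
    using Rats_abs_nat_div_natE[OF r(1)] by blast
  then obtain b' where "b = Suc b'" using not0_implies_Suc by blast
  then have r_eq: "real a / real (Suc b') = r" using ab \<open>r > 0\<close> by simp
  define q where "q = prod_encode (a, b')"
  have code: "prod_encode (m, q) \<in> measure_code \<mu> \<longleftrightarrow>
      (\<exists>t. m = str_code t \<and> r < measure \<mu> (cyl t))" for m
    unfolding measure_code_def q_def using r_eq by auto
  have "{n. x n} = {n. \<exists>t. n < length t \<and> t ! n \<and> r < measure \<mu> (cyl t) \<and>
      (\<forall>i<l. i < length t \<and> t ! i \<longleftrightarrow> x i)}" (is "_ = ?B")
  proof (intro set_eqI iffI)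
    fix n assume n: "n \<in> {n. x n}"
    \<comment> \<open>Long enough both to reach position \<open>n\<close> and to fix the first
      \<open>l\<close> bits.\<close>
    define t where "t = map x [0..<max (Suc n) l]"
    have "measure \<mu> {x} \<le> measure \<mu> (cyl t)"
      using sets by (intro finite_measure_mono) (auto simp: t_def mem_cyl_map_upt)
    then have "r < measure \<mu> (cyl t)" using r(3) by simp
    moreover have "n < length t" "t ! n" "\<forall>i<l. i < length t \<and> t ! i \<longleftrightarrow> x i"
      using n by (auto simp: t_def)
    ultimately show "n \<in> ?B" by blast
  next
    fix n assume "n \<in> ?B"
    then obtain t where t: "n < length t" "t ! n" "r < measure \<mu> (cyl t)"
      "\<forall>i<l. i < length t \<and> t ! i \<longleftrightarrow> x i" by blast
    show "n \<in> {n. x n}"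
    proof (rule ccontr)
      assume n: "n \<notin> {n. x n}"
      \<comment> \<open>Below \<open>l\<close> the bits of \<open>t\<close> are those of
        \<open>x\<close>, so the disagreement lies at or beyond \<open>l\<close>. Hence
        \<open>t\<close> is longer than \<open>l\<close>, and none of its first \<open>l\<close>
        bits is a default value.\<close>
      with t have "l \<le> n" by (metis mem_Collect_eq not_le)
      then have "cyl t \<subseteq> N l" using t by (auto simp: N_def mem_cyl_map_upt cyl_def)
      moreover have "x \<notin> cyl t" using n t by (auto simp: cyl_def)
      ultimately have "measure \<mu> (cyl t) \<le> measure \<mu> (N l - {x})"
        using sets N by (intro finite_measure_mono) auto
      also have "\<dots> = measure \<mu> (N l) - measure \<mu> {x}"
        using sets N by (intro finite_measure_Diff) auto
      finally show False using r(2) t(3) by simp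
    qed
  qed
  also have "\<dots> = {n. \<exists>t. code_bit n (str_code t) \<and> r < measure \<mu> (cyl t) \<and>
      (\<forall>i<l. code_bit i (str_code t) \<longleftrightarrow> x i)}"
    by (simp add: code_bit_str_code conj_assoc)
  also have "\<dots> = {n. \<exists>m. code_bit n m \<and> prod_encode (m, q) \<in> measure_code \<mu> \<and>
      (\<forall>i<l. code_bit i m \<longleftrightarrow> x i)}"
    unfolding code by blast
  finally show thesis by (rule that)
qed

text \<open>The set \<open>{x}\<close> and its complement separate the two measures. Both orders are
  recorded because the condition on a family ranges over ordered pairs.\<close>

lemma orthogonal_return:
  assumes "\<mu> \<in> P_cantor" "measure \<mu> {x} = 0"
  shows "orthogonal_measures \<mu> (return borel x)" "orthogonal_measures (return borel x) \<mu>"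
proof -
  interpret prob_space \<mu> using assms(1) by (simp add: P_cantor_def)
  have sets: "{x} \<in> sets \<mu>" and space: "space \<mu> = UNIV"
    using assms(1) singleton_in_borel sets_eq_imp_space_eq[of \<mu> borel] by (auto simp: P_cantor_def)
  have null: "emeasure \<mu> {x} = 0" using assms(2) by (simp add: emeasure_eq_measure)
  show "orthogonal_measures \<mu> (return borel x)"
    unfolding orthogonal_measures_def using null singleton_in_borel
    by (intro bexI[of _ "{x}"]) auto
  have "emeasure \<mu> (- {x}) = 1"
    using sets space assms(2) prob_compl[of "{x}"]
    by (simp add: emeasure_eq_measure Compl_eq_Diff_UNIV)
  then show "orthogonal_measures (return borel x) \<mu>"
    unfolding orthogonal_measures_def using singleton_in_borel[of x]
    by (intro bexI[of _ "- {x}"]) (auto intro: borel_comp)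
qed

theorem theorem2p1:
  fixes \<phi> :: so_fm and R :: "nat set set" and A :: "cantor measure set"
  assumes "R = L_reals TYPE('v::set_universe)"
    and "Sigma12 \<phi>" and "so_sfv \<phi> \<subseteq> {0}" and "so_nfv \<phi> = {}"
    and "A = {\<mu> \<in> P_in R. holds_of_measure R \<phi> \<mu>}"
    and "mof_in R A"
    and "\<exists>x. x \<notin> R"
  shows "\<not> mof A"
proof
  assume "mof A"
  then have family: "orthogonal_family P_cantor orthogonal_measures A"
    and maximal: "\<And>A'. orthogonal_family P_cantor orthogonal_measures A' \<Longrightarrow> A \<subseteq> A' \<Longrightarrow> A' = A"
    unfolding mof_def mof_wrt_def by auto
  obtain y where "y \<notin> R" using assms(7) by blast
  \<comment> \<open>The set \<open>y\<close> is turned into a point of Cantor space by its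
    characteristic function.\<close>
  then obtain x :: cantor where x: "{n. x n} \<notin> R" by (metis Collect_mem_eq)
  define \<delta> where "\<delta> = return (borel :: cantor measure) x"
  have \<delta>: "\<delta> \<in> P_cantor" "measure \<delta> {x} \<noteq> 0"
    using singleton_in_borel[of x] 
    by (auto simp: \<delta>_def P_cantor_def measure_return intro: prob_space_return)
  \<comment> \<open>If \<open>x\<close> were an atom of \<open>\<mu>\<close>, it would be definable
    from the code of \<open>\<mu>\<close> and thus belong to \<open>R\<close>.\<close>
  have null: "measure \<mu> {x} = 0" if "\<mu> \<in> A" for \<mu>
  proof (rule ccontr)
    assume "measure \<mu> {x} \<noteq> 0"
    then have "measure \<mu> {x} > 0" by (simp add: zero_less_measure_iff)
    moreover have \<mu>: "\<mu> \<in> P_cantor" "measure_code \<mu> \<in> R"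
      using \<open>\<mu> \<in> A\<close> assms(5) by (auto simp: P_in_def)
    ultimately obtain q l where "{n. x n} = {n. \<exists>m. code_bit n m \<and>
        prod_encode (m, q) \<in> measure_code \<mu> \<and> (\<forall>i<l. code_bit i m \<longleftrightarrow> x i)}"
      using atom_definable by blast
    then show False using x \<mu>(2) L_reals_branch[where 'v = 'v, of "measure_code \<mu>" q l x] assms(1) by simp
  qed
  have "A \<subseteq> P_cantor" using family by (simp add: orthogonal_family_def)
  then have "orthogonal_family P_cantor orthogonal_measures (insert \<delta> A)"
    using family \<delta>(1) orthogonal_return[OF _ null] by (auto simp: orthogonal_family_def \<delta>_def)
  \<comment> \<open>Members of the family give \<open>x\<close> mass zero, so membership of the
    point mass is absurd.\<close>
  then have "\<delta> \<in> A" using maximal[of "insert \<delta> A"] by blast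
  then show False using null \<delta>(2) by blast
qed

end
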